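(* Let $n$ be a positive integer, let $d = \binom{n+1}{2}-1$, and let $B_1,\ldots,B_d$ be any basis for the $d$-dimensional space of real symmetric $n\times n$ matrices with trace zero. For a real symmetric $n\times n$ matrix $X$, let $\mathcal{B}(X)$ be the $d\times d$ symmetric matrix with $(i,j)$ entry equal to $\operatorname{tr}(B_i X B_j)$. Then $$\mathcal{S}_+^{n,(1)} = \{X\in \mathcal{S}^n : \mathcal{B}(X) \succeq 0\}.$$
   Context: $\mathcal{S}^n$ denotes the space of real symmetric $n\times n$ matrices, and $M\succeq 0$ means that the symmetric matrix $M$ is positive semidefinite. A homogeneous real polynomial $p$ on a finite-dimensional real vector space $V$ is hyperbolic with respect to $e\in V$ if $p(e)\neq 0$ and for all $x\in V$ the univariate polynomial $t\mapsto p(x-te)$ has only real roots. Its closed hyperbolicity cone is $\Lambda_+(p,e)=\{x\in V : \text{all roots of } t\mapsto p(x-te) \text{ are non-negative}\}$. For $X\in\mathcal{S}^n$, $E_{n-1}(X)$ denotes the elementary symmetric polynomial of degree $n-1$ in the eigenvalues of $X$; equivalently, it is the coefficient of $t$ in $\det(X+tI_n)$, i.e. the directional derivative of $\det$ at $X$ in the direction of the identity matrix $I_n$. It is hyperbolic with respect to $I_n$. The cone $\mathcal{S}_+^{n,(1)}$ (the first derivative relaxation of the positive semidefinite cone) is defined as $\mathcal{S}_+^{n,(1)}=\Lambda_+(E_{n-1},I_n)$. *)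

theory Defs
  imports
    "HOL-Analysis.Analysis"
    "HOL-Computational_Algebra.Polynomial"
    "HOL-Library.Nonpos_Ints"
begin

definition sym_matrices :: "(real ^ 'n ^ 'n) set" where
  "sym_matrices = {X. transpose X = X}"

text \<open>
  A family indexed by a finite set \<open>I\<close> is a basis of the subspace \<open>V\<close>. Injectivity is needed
  because \<^const>\<open>independent\<close> is a property of the set of values, not of the family.
\<close>

definition basis_family :: "'i set \<Rightarrow> ('i \<Rightarrow> 'a::real_vector) \<Rightarrow> 'a set \<Rightarrow> bool" where
  "basis_family I B V \<longleftrightarrow> finite I \<and> inj_on B I \<and> independent (B ` I) \<and> span (B ` I) = V"

text \<open>
  A square matrix with rows and columns indexed by \<open>I\<close> is a function of two indices of which
  only the values on \<open>I\<close> matter. Explicit index sets, unlike index types, allow size zero.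
\<close>

definition psd_on :: "'i set \<Rightarrow> ('i \<Rightarrow> 'i \<Rightarrow> real) \<Rightarrow> bool" where
  "psd_on I M \<longleftrightarrow>
     (\<forall>i\<in>I. \<forall>j\<in>I. M i j = M j i) \<and>
     (\<forall>c :: 'i \<Rightarrow> real. (\<Sum>i\<in>I. \<Sum>j\<in>I. c i * M i j * c j) \<ge> 0)"

text \<open>
  The closed hyperbolicity cone of \<open>p\<close> in the space \<open>V\<close>. The polynomial \<open>q\<close> is uniquely
  determined by its values, and its roots are taken over the complex numbers, so that \<open>all roots
  are non-negative\<close> includes that they are all real.
\<close>

definition hyperbolicity_cone ::
    "'a::real_vector set \<Rightarrow> ('a \<Rightarrow> real) \<Rightarrow> 'a \<Rightarrow> 'a set" where
  "hyperbolicity_cone V p e =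
     {x \<in> V. \<exists>q :: real poly.
        (\<forall>t. poly q t = p (x - t *\<^sub>R e)) \<and>
        (\<forall>z :: complex. poly (map_poly complex_of_real q) z = 0 \<longrightarrow> z \<in> \<real>\<^sub>\<ge>\<^sub>0)}"

text \<open>
  The polynomial \<open>det (X + t I)\<close> in the indeterminate \<open>t\<close>, and its coefficient of \<open>t\<close>.
\<close>

definition det_shift :: "real ^ 'n ^ 'n \<Rightarrow> real poly" where
  "det_shift X = det (\<chi> i j. [:X $ i $ j, if i = j then 1 else 0:])"

definition E_pred :: "real ^ 'n ^ 'n \<Rightarrow> real" where
  "E_pred X = coeff (det_shift X) 1"

definition first_derivative_relaxation :: "(real ^ 'n ^ 'n) set" where
  "first_derivative_relaxation = hyperbolicity_cone sym_matrices E_pred (mat 1)"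

lemma poly_det_shift: "poly (det_shift X) t = det (X + t *\<^sub>R mat 1)"
  unfolding det_shift_def det_def poly_sum poly_prod
  by (auto simp: mat_def poly_prod of_int_poly intro!: sum.cong prod.cong)

lemma coeff_0_prod_linear:
  "coeff (\<Prod>i\<in>S. [:l i, 1:] :: real poly) 0 = (\<Prod>i\<in>S. l i)"
  by (simp add: poly_0_coeff_0 [symmetric] poly_prod)

lemma coeff_1_prod_linear:
  assumes "finite S"
  shows "coeff (\<Prod>i\<in>S. [:l i, 1:] :: real poly) 1 = (\<Sum>i\<in>S. \<Prod>j\<in>S - {i}. l j)"
  using assms
proof (induction S rule: finite_induct)
  case empty
  then show ?case by simp
next
  case (insert x S)
  have eq: "(\<Prod>j\<in>insert x S - {i}. l j) = l x * (\<Prod>j\<in>S - {i}. l j)" if "i \<in> S" for i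
    using insert.hyps that by (subst insert_Diff_if) (auto simp: prod.insert)
  show ?case
    using insert coeff_0_prod_linear[of l S]
    by (simp add: eq sum_distrib_left)
qed

text \<open>
  If \<open>l\<close> lists the eigenvalues of \<open>X\<close> with multiplicity, then \<^const>\<open>E_pred\<close> is their elementary
  symmetric polynomial of degree one less than the size of \<open>X\<close>.
\<close>

lemma E_pred_eigenvalues:
  fixes X :: "real ^ 'n ^ 'n" and l :: "'n \<Rightarrow> real"
  assumes "\<And>t. det (t *\<^sub>R mat 1 - X) = (\<Prod>i\<in>UNIV. t - l i)"
  shows "E_pred X = (\<Sum>i\<in>UNIV. \<Prod>j\<in>UNIV - {i}. l j)"
proof -
  have "poly (det_shift X) t = poly (\<Prod>i\<in>UNIV. [:l i, 1:]) t" for t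
  proof -
    have m: "X + t *\<^sub>R mat 1 = (\<chi> i. (-1) *s (((-t) *\<^sub>R mat 1 - X) $ i))"
      by (simp add: vec_eq_iff)
    have "det (X + t *\<^sub>R mat 1) = (\<Prod>i\<in>(UNIV::'n set). -1) * (\<Prod>i\<in>UNIV. - t - l i)"
      unfolding m det_rows_mul vec_lambda_eta by (simp only: assms)
    also have "\<dots> = (\<Prod>i\<in>UNIV. t + l i)"
      unfolding prod.distrib[symmetric] by (simp add: algebra_simps)
    finally show ?thesis
      by (simp add: poly_det_shift poly_prod add.commute)
  qed
  then have "det_shift X = (\<Prod>i\<in>UNIV. [:l i, 1:])"
    by (simp add: poly_eq_poly_eq_iff[symmetric] fun_eq_iff)
  then show ?thesis
    by (simp add: E_pred_def coeff_1_prod_linear[unfolded One_nat_def])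
qed

end

theory Submission
  imports Defs
begin

text \<open>
  By a change of basis, \<open>\<B>(X)\<close> is positive semidefinite iff \<open>tr (A X A) \<ge> 0\<close> for all symmetric
  \<open>A\<close> of trace zero. Diagonalizing \<open>X\<close>, with eigenvalues \<open>l\<^sub>i\<close>, this says that
  \<open>\<Sum> l\<^sub>i a\<^sub>i\<^sup>2 \<ge> 0\<close> whenever \<open>\<Sum> a\<^sub>i = 0\<close>: the off-diagonal entries of \<open>A\<close> only contribute the
  conditions \<open>l\<^sub>i + l\<^sub>j \<ge> 0\<close>, which are the case \<open>a = e\<^sub>i - e\<^sub>j\<close>.

  If \<open>\<mu>\<^sub>i = l\<^sub>i - t\<close> are all nonzero, then \<open>E\<^sub>n\<^sub>-\<^sub>1(\<mu>) = \<Prod> \<mu>\<^sub>i \<cdot> \<Sum> 1 / \<mu>\<^sub>i\<close>. A root \<open>t < 0\<close> of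
  \<open>E\<^sub>n\<^sub>-\<^sub>1(l - t)\<close> therefore yields the isotropic vector \<open>a\<^sub>i = 1 / \<mu>\<^sub>i\<close> (or \<open>e\<^sub>i - e\<^sub>j\<close> if
  \<open>\<mu>\<^sub>i = \<mu>\<^sub>j = 0\<close>) of \<open>\<Sum> \<mu>\<^sub>i a\<^sub>i\<^sup>2\<close>, which would be positive definite on the zero-sum hyperplane.
  Conversely, the minimum of \<open>\<Sum> l\<^sub>i a\<^sub>i\<^sup>2\<close> over zero-sum unit vectors is a root of \<open>E\<^sub>n\<^sub>-\<^sub>1(l - t)\<close>,
  because the Lagrange condition says that \<open>(l\<^sub>i - t) a\<^sub>i\<close> is constant at the minimizer. Hence it
  is nonnegative if all roots are.
\<close>

text \<open>First-order condition at a minimum: for small \<open>s\<close> of sign opposite to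
  \<open>b\<close> the linear term would dominate and make the expression negative.\<close>

lemma nonneg_quadratic_linear_term_zero:
  fixes b c :: real
  assumes "\<And>s. 0 \<le> 2 * s * b + s\<^sup>2 * c"
  shows "b = 0"
proof (rule ccontr)
  assume "b \<noteq> 0"
  \<comment> \<open>The minimizer after \<open>c\<close> is replaced by the larger, strictly
    positive \<open>\<bar>c\<bar> + 1\<close>; the minimum is then \<open>s * b\<close>.\<close>
  define s where "s = - b / (\<bar>c\<bar> + 1)"
  have s: "(\<bar>c\<bar> + 1) * s = - b"
    by (simp add: s_def)
  have "0 \<le> 2 * s * b + s\<^sup>2 * c"
    by (rule assms)
  also have "\<dots> \<le> 2 * s * b + s\<^sup>2 * (\<bar>c\<bar> + 1)"
    by (intro add_left_mono mult_left_mono) auto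
  also have "s\<^sup>2 * (\<bar>c\<bar> + 1) = s * - b"
    by (simp only: s [symmetric] power2_eq_square mult_ac)
  finally have "0 \<le> s * b"
    by (simp add: mult.commute)
  moreover have "s * b = - (b\<^sup>2 / (\<bar>c\<bar> + 1))"
    by (simp add: s_def power2_eq_square)
  ultimately show False
    using \<open>b \<noteq> 0\<close> by (simp add: divide_le_0_iff add_nonneg_pos)
qed

section \<open>Orthogonal diagonalization of real symmetric matrices\<close>

text \<open>Minimize the Rayleigh quotient on the unit sphere of \<open>S\<close>. At a minimizer
  \<open>v\<close> the residual \<open>X *v v - m *\<^sub>R v\<close> is orthogonal to
  \<open>S\<close>, and it lies in \<open>S\<close> by invariance, so it vanishes.\<close>

lemma symmetric_invariant_subspace_eigenvector:
  fixes X :: "real ^ 'n ^ 'n"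
  assumes sym: "transpose X = X" and S: "subspace S" "S \<noteq> {0}"
    and inv: "\<And>x. x \<in> S \<Longrightarrow> X *v x \<in> S"
  obtains v m where "v \<in> S" "norm v = 1" "X *v v = m *\<^sub>R v"
proof -
  have adj: "(X *v x) \<bullet> y = x \<bullet> (X *v y)" for x y
    by (metis dot_lmul_matrix sym transpose_matrix_vector)
  let ?K = "S \<inter> sphere 0 1"
  obtain y where y: "y \<in> S" "y \<noteq> 0"
    using S subspace_0 by blast
  have "y /\<^sub>R norm y \<in> ?K"
    using y S(1) by (simp add: subspace_scale)
  then have "?K \<noteq> {}"
    by blast
  moreover have "compact ?K"
    by (simp add: closed_Int_compact closed_subspace S(1))
  moreover have "continuous_on ?K (\<lambda>x. x \<bullet> (X *v x))"
    by (intro continuous_intros)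
  ultimately obtain v where v: "v \<in> S" "norm v = 1"
    and min: "\<And>x. x \<in> ?K \<Longrightarrow> v \<bullet> (X *v v) \<le> x \<bullet> (X *v x)"
    using continuous_attains_inf [of ?K "\<lambda>x. x \<bullet> (X *v x)"] by fastforce
  define m where "m = v \<bullet> (X *v v)"
  have low: "m * (x \<bullet> x) \<le> x \<bullet> (X *v x)" if "x \<in> S" for x
  proof (cases "x = 0")
    case False
    have "x /\<^sub>R norm x \<in> ?K"
      using False that S(1) by (simp add: subspace_scale)
    from min [OF this] have "m \<le> (x \<bullet> (X *v x)) / (norm x)\<^sup>2"
      by (simp add: m_def matrix_vector_mult_scaleR power2_eq_square field_simps)
    then show ?thesis
      using False by (simp add: power2_norm_eq_inner pos_le_divide_eq)
  qed auto
  \<comment> \<open>The residual is half the gradient at \<open>v\<close> of the form bounded below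
    in \<open>low\<close>, which is zero at \<open>v\<close>; vary \<open>v\<close> in the direction
    \<open>h\<close>.\<close>
  have "(X *v v - m *\<^sub>R v) \<bullet> h = 0" if "h \<in> S" for h
  proof (rule nonneg_quadratic_linear_term_zero)
    fix s :: real
    have "v + s *\<^sub>R h \<in> S"
      using v that S(1) by (simp add: subspace_add subspace_scale)
    from low [OF this] show "0 \<le> 2 * s * ((X *v v - m *\<^sub>R v) \<bullet> h) + s\<^sup>2 * (h \<bullet> (X *v h) - m * (h \<bullet> h))"
      using adj [of v h] v(2)
      by (simp add: matrix_vector_mult_scaleR matrix_vector_right_distrib inner_simps m_def
          power2_eq_square algebra_simps inner_commute norm_eq_1)
  qed
  moreover have "X *v v - m *\<^sub>R v \<in> S"
    using v S(1) inv by (simp add: subspace_diff subspace_scale)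
  ultimately have "X *v v = m *\<^sub>R v"
    by (metis inner_eq_zero_iff eq_iff_diff_eq_0)
  then show ?thesis
    using that v by blast
qed

text \<open>Induction on the dimension: split off a unit eigenvector \<open>v\<close>; its
  orthogonal complement in \<open>S\<close> is again invariant because \<open>X\<close> is
  self-adjoint.\<close>

lemma symmetric_invariant_subspace_eigenbasis:
  fixes X :: "real ^ 'n ^ 'n"
  assumes sym: "transpose X = X" and "subspace S" and "\<And>x. x \<in> S \<Longrightarrow> X *v x \<in> S"
  shows "\<exists>U. pairwise orthogonal U \<and> (\<forall>u\<in>U. norm u = 1 \<and> (\<exists>m. X *v u = m *\<^sub>R u)) \<and> span U = S"
  using assms(2,3)
proof (induction "dim S" arbitrary: S rule: less_induct)
  case less
  show ?case
  proof (cases "S = {0}")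
    case True
    then show ?thesis
      by (intro exI [of _ "{}"]) auto
  next
    case False
    then obtain v m where v: "v \<in> S" "norm v = 1" "X *v v = m *\<^sub>R v"
      using symmetric_invariant_subspace_eigenvector [OF sym less.prems(1) _ less.prems(2)] by blast
    define T where "T = S \<inter> {x. orthogonal v x}"
    have T: "subspace T"
      unfolding T_def by (intro subspace_inter less.prems subspace_orthogonal_to_vector)
    have "v \<notin> T"
      using v by (auto simp: T_def orthogonal_def)
    then have "dim T < dim S"
      using v T less.prems(1) by (intro dim_psubset) (auto simp: T_def span_eq_iff [THEN iffD2])
    moreover have "X *v x \<in> T" if "x \<in> T" for x
    proof -
      have "v \<bullet> (X *v x) = (X *v v) \<bullet> x"
        by (metis dot_lmul_matrix sym transpose_matrix_vector)
      then show ?thesis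
        using that less.prems(2) v by (auto simp: T_def orthogonal_def)
    qed
    ultimately obtain U where U: "pairwise orthogonal U"
      "\<forall>u\<in>U. norm u = 1 \<and> (\<exists>m. X *v u = m *\<^sub>R u)" "span U = T"
      using less.hyps [of T] T by blast
    have "U \<subseteq> T"
      using U(3) span_superset by blast
    then have "pairwise orthogonal (insert v U)"
      using U(1) by (auto simp: pairwise_insert T_def orthogonal_commute)
    moreover have "span (insert v U) = S"
    proof
      show "span (insert v U) \<subseteq> S"
        using \<open>U \<subseteq> T\<close> v less.prems(1) by (intro span_minimal) (auto simp: T_def)
      show "S \<subseteq> span (insert v U)"
      proof
        fix x assume "x \<in> S"
        then have "x - (x \<bullet> v) *\<^sub>R v \<in> T"
          using v less.prems(1)
          by (auto simp: T_def orthogonal_def inner_simps inner_commute norm_eq_1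
              intro!: subspace_diff subspace_scale)
        then show "x \<in> span (insert v U)"
          using U(3) span_breakdown_eq by blast
      qed
    qed
    ultimately show ?thesis
      using U(2) v by (intro exI [of _ "insert v U"]) auto
  qed
qed

definition diag_mat :: "('n \<Rightarrow> real) \<Rightarrow> real ^ 'n ^ 'n" where
  "diag_mat l = (\<chi> i j. if i = j then l i else 0)"

lemma symmetric_matrix_diagonalization:
  fixes X :: "real ^ 'n ^ 'n"
  assumes "transpose X = X"
  obtains Q l where "orthogonal_matrix Q" "X = Q ** diag_mat l ** transpose Q"
proof -
  obtain U where U: "pairwise orthogonal U"
      "\<forall>u\<in>U. norm u = 1 \<and> (\<exists>m. X *v u = m *\<^sub>R u)" "span U = UNIV"
    using symmetric_invariant_subspace_eigenbasis [OF assms subspace_UNIV] by auto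
  have indep: "independent U"
    using U by (intro pairwise_orthogonal_independent) auto
  then have "card U = CARD('n)"
    using U(3) by (metis dim_UNIV dim_eq_card_independent dim_span DIM_cart DIM_real mult_1_right)
  moreover have "finite U"
    using indep by (rule independent_imp_finite)
  \<comment> \<open>Number the eigenbasis by the index type, so that its vectors can serve as the
    columns of \<open>Q\<close>.\<close>
  ultimately obtain f where f: "bij_betw f (UNIV :: 'n set) U"
    using finite_same_card_bij [of "UNIV :: 'n set" U] by auto
  then have fU: "f i \<in> U" for i
    by (auto simp: bij_betw_def)
  have "\<forall>i. \<exists>m. X *v f i = m *\<^sub>R f i"
    using U(2) fU by blast
  then obtain l where l: "\<And>i. X *v f i = l i *\<^sub>R f i"
    by metis
  have "f i \<noteq> f j" if "i \<noteq> j" for i j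
    using f that by (auto simp: bij_betw_def dest: injD)
  then have on: "f i \<bullet> f j = (if i = j then 1 else 0)" for i j
    using U(1,2) fU [of i] fU [of j] by (auto simp: pairwise_def orthogonal_def norm_eq_1)
  define Q :: "real ^ 'n ^ 'n" where "Q = transpose (\<chi> j. f j)"
  have QQ: "transpose Q ** Q = mat 1"
    by (simp add: Q_def transpose_def matrix_matrix_mult_def mat_def vec_eq_iff
        on [unfolded inner_vec_def, simplified])
  then have Q: "orthogonal_matrix Q"
    by (simp add: orthogonal_matrix)
  have "(X ** Q) $ i $ j = (Q ** diag_mat l) $ i $ j" for i j
  proof -
    have "(X ** Q) $ i $ j = (X *v f j) $ i"
      by (simp add: Q_def transpose_def matrix_matrix_mult_def matrix_vector_mult_def)
    also have "\<dots> = (Q ** diag_mat l) $ i $ j"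
      by (simp add: l Q_def transpose_def matrix_matrix_mult_def diag_mat_def if_distrib cong: if_cong)
    finally show ?thesis .
  qed
  then have "X ** Q = Q ** diag_mat l"
    by (simp add: vec_eq_iff)
  then have "X = Q ** diag_mat l ** transpose Q"
    using Q by (metis matrix_mul_assoc matrix_mul_rid orthogonal_matrix_def)
  then show ?thesis
    using that Q by blast
qed

section \<open>The relaxation in terms of eigenvalues\<close>

text \<open>Elementary symmetric polynomial of degree one less than the number of variables. The
  ring is arbitrary because real, complex and polynomial arguments all occur.\<close>

definition pred_esym :: "('n::finite \<Rightarrow> 'a::comm_ring_1) \<Rightarrow> 'a" where
  "pred_esym l = (\<Sum>i\<in>UNIV. \<Prod>j\<in>UNIV - {i}. l j)"

lemma pred_esym_eq_prod_mult_sum_inverse: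
  fixes l :: "'n::finite \<Rightarrow> 'a::field"
  assumes "\<And>i. l i \<noteq> 0"
  shows "pred_esym l = (\<Prod>i\<in>UNIV. l i) * (\<Sum>i\<in>UNIV. inverse (l i))"
  unfolding pred_esym_def sum_distrib_left
proof (rule sum.cong)
  fix i :: 'n
  show "(\<Prod>j\<in>UNIV - {i}. l j) = (\<Prod>i\<in>UNIV. l i) * inverse (l i)"
    using assms [of i] by (simp add: prod.remove [of UNIV i])
qed simp

lemma pred_esym_two_zeros:
  fixes l :: "'n::finite \<Rightarrow> 'a::comm_ring_1"
  assumes "i \<noteq> j" "l i = 0" "l j = 0"
  shows "pred_esym l = 0"
  unfolding pred_esym_def
proof (intro sum.neutral ballI)
  fix k
  show "(\<Prod>j\<in>UNIV - {k}. l j) = 0"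
    using assms by (cases "k = i") (auto intro!: prod_zero)
qed

lemma pred_esym_single_zero:
  fixes l :: "'n::finite \<Rightarrow> 'a::comm_ring_1"
  assumes "l k = 0"
  shows "pred_esym l = (\<Prod>j\<in>UNIV - {k}. l j)"
proof -
  have "(\<Prod>j\<in>UNIV - {i}. l j) = 0" if "i \<noteq> k" for i
    using assms that by (auto intro!: prod_zero)
  then show ?thesis
    unfolding pred_esym_def by (subst sum.remove [of _ k]) (auto intro!: sum.neutral)
qed

text \<open>Hyperbolicity in eigenvalue form: the imaginary part of each
  \<open>1 / (l i - z)\<close> has the sign of \<open>Im z\<close>, so the sum of these inverses
  cannot vanish.\<close>

lemma pred_esym_nonreal_shift:
  fixes l :: "'n::finite \<Rightarrow> real"
  assumes "Im z \<noteq> 0"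
  shows "pred_esym (\<lambda>i. complex_of_real (l i) - z) \<noteq> 0"
proof -
  have nz: "complex_of_real (l i) - z \<noteq> 0" for i
    using assms by (auto simp: complex_eq_iff)
  have "Im (\<Sum>i\<in>UNIV. inverse (complex_of_real (l i) - z)) =
      Im z * (\<Sum>i\<in>UNIV. 1 / (cmod (complex_of_real (l i) - z))\<^sup>2)"
    by (simp add: sum_distrib_left cmod_def)
  moreover have "(\<Sum>i\<in>(UNIV :: 'n set). 1 / (cmod (complex_of_real (l i) - z))\<^sup>2) > 0"
    using nz by (intro sum_pos) auto
  ultimately have "(\<Sum>i\<in>UNIV. inverse (complex_of_real (l i) - z)) \<noteq> 0"
    using assms by (metis less_irrefl mult_eq_0_iff zero_complex.sel(2))
  then show ?thesis
    using nz by (simp add: pred_esym_eq_prod_mult_sum_inverse)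
qed

section \<open>Negative roots and the quadratic form on zero-sum vectors\<close>

lemma pred_esym_shift_nonzero:
  fixes l :: "'n::finite \<Rightarrow> real"
  assumes psd: "\<And>a. (\<Sum>i\<in>UNIV. a i) = 0 \<Longrightarrow> 0 \<le> (\<Sum>i\<in>UNIV. l i * (a i)\<^sup>2)" and "t < 0"
  shows "pred_esym (\<lambda>i. l i - t) \<noteq> 0"
proof
  assume zero: "pred_esym (\<lambda>i. l i - t) = 0"
  have pos: "(\<Sum>i\<in>UNIV. (l i - t) * (a i)\<^sup>2) > 0" if "(\<Sum>i\<in>UNIV. a i) = 0" "a k \<noteq> 0" for a k
  proof -
    have "(\<Sum>i\<in>UNIV. (a i)\<^sup>2) > 0"
      using that(2) by (intro sum_pos2 [of _ k]) auto
    then have "- t * (\<Sum>i\<in>UNIV. (a i)\<^sup>2) > 0"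
      using \<open>t < 0\<close> by (simp add: mult_neg_pos)
    then show ?thesis
      using psd [OF that(1)] by (simp add: left_diff_distrib sum_subtractf sum_distrib_left sum_negf)
  qed
  show False
  proof (cases "\<exists>k. l k - t = 0")
    case True
    then obtain k where k: "l k - t = 0" ..
    \<comment> \<open>With a zero at \<open>k\<close> only the product omitting \<open>k\<close>
      survives, so one of the other factors vanishes too.\<close>
    then obtain j where j: "j \<noteq> k" "l j - t = 0"
      using zero by (auto simp: pred_esym_single_zero [where k = k])
    let ?a = "\<lambda>i. (if i = k then 1 else 0) - (if i = j then 1 else 0) :: real"
    have "(\<Sum>i\<in>UNIV. ?a i) = 0"
      by (simp add: sum_subtractf)
    then have "(\<Sum>i\<in>UNIV. (l i - t) * (?a i)\<^sup>2) > 0"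
      using j by (intro pos [of _ k]) auto
    moreover have "(\<Sum>i\<in>UNIV. (l i - t) * (?a i)\<^sup>2) = 0"
      using j k by (intro sum.neutral) auto
    ultimately show False
      by simp
  next
    case False
    then have nz: "l i - t \<noteq> 0" for i
      by blast
    then have s: "(\<Sum>i\<in>UNIV. inverse (l i - t)) = 0"
      using zero by (simp add: pred_esym_eq_prod_mult_sum_inverse)
    \<comment> \<open>By \<open>s\<close> the inverses form a zero-sum vector, and the form takes at
      it the same value zero. All entries are nonzero, so \<open>undefined\<close> serves as an
      arbitrary index.\<close>
    then have "(\<Sum>i\<in>UNIV. (l i - t) * (inverse (l i - t))\<^sup>2) > 0"
      using nz by (intro pos [of _ undefined]) auto
    moreover have "(l i - t) * (inverse (l i - t))\<^sup>2 = inverse (l i - t)" for i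
      using nz [of i] by (simp add: power2_eq_square)
    ultimately show False
      using s by simp
  qed
qed

lemma pred_esym_shift_zero_at_minimum:
  fixes l a :: "'n::finite \<Rightarrow> real"
  assumes low: "\<And>x. (\<Sum>i\<in>UNIV. x i) = 0 \<Longrightarrow> 0 \<le> (\<Sum>i\<in>UNIV. (l i - m) * (x i)\<^sup>2)"
    and a: "(\<Sum>i\<in>UNIV. a i) = 0" "(\<Sum>i\<in>UNIV. (l i - m) * (a i)\<^sup>2) = 0" "a k \<noteq> 0"
  shows "pred_esym (\<lambda>i. l i - m) = 0"
proof -
  have eq: "(l i - m) * a i = (l j - m) * a j" if "i \<noteq> j" for i j
  proof -
    \<comment> \<open>Varying \<open>a\<close> along \<open>e_i - e_j\<close> stays in the
      hyperplane and compares just two components of the gradient.\<close>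
    define h where "h = (\<lambda>r. (if r = i then 1 else 0) - (if r = j then 1 else 0) :: real)"
    have h0: "(\<Sum>r\<in>UNIV. h r) = 0"
      by (simp add: h_def sum_subtractf)
    have "(\<Sum>r\<in>UNIV. (l r - m) * a r * h r) = 0"
    proof (rule nonneg_quadratic_linear_term_zero)
      fix s :: real
      have "(\<Sum>r\<in>UNIV. a r + s * h r) = 0"
        by (simp add: sum.distrib a(1) h0 flip: sum_distrib_left)
      from low [OF this]
      have "0 \<le> (\<Sum>r\<in>UNIV. (l r - m) * (a r + s * h r)\<^sup>2)" .
      also have "\<dots> = (\<Sum>r\<in>UNIV. (l r - m) * (a r)\<^sup>2) + 2 * s * (\<Sum>r\<in>UNIV. (l r - m) * a r * h r)
          + s\<^sup>2 * (\<Sum>r\<in>UNIV. (l r - m) * (h r)\<^sup>2)"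
        unfolding sum_distrib_left sum.distrib [symmetric]
        by (intro sum.cong) (auto simp: power2_eq_square algebra_simps)
      finally show "0 \<le> 2 * s * (\<Sum>r\<in>UNIV. (l r - m) * a r * h r)
          + s\<^sup>2 * (\<Sum>r\<in>UNIV. (l r - m) * (h r)\<^sup>2)"
        by (simp add: a(2))
    qed
    moreover have "(l r - m) * a r * h r =
        (if r = i then (l r - m) * a r else 0) - (if r = j then (l r - m) * a r else 0)" for r
      by (simp add: h_def)
    ultimately show ?thesis
      by (simp add: sum_subtractf)
  qed
  \<comment> \<open>\<open>c\<close> is the Lagrange multiplier of the zero-sum constraint.\<close>
  define c where "c = (l k - m) * a k"
  have c: "(l i - m) * a i = c" for i
    using eq [of i k] by (cases "i = k") (auto simp: c_def)
  show ?thesis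
  proof (cases "c = 0")
    \<comment> \<open>Now \<open>l i = m\<close> wherever \<open>a i\<close> is nonzero, and a
      nonzero zero-sum vector has at least two nonzero entries.\<close>
    case True
    have "(\<Sum>i\<in>UNIV - {k}. a i) \<noteq> 0"
      using a(1,3) by (auto simp: sum.remove [of UNIV k])
    then obtain j where "j \<noteq> k" "a j \<noteq> 0"
      by (metis DiffE singletonI sum.neutral)
    then show ?thesis
      using c [of j] c [of k] a(3) True by (intro pred_esym_two_zeros [of j k]) auto
  next
    case False
    then have nz: "l i - m \<noteq> 0" for i
      using c [of i] by auto
    \<comment> \<open>Solving \<open>c\<close> for the minimizer gives
      \<open>a i = c / (l i - m)\<close>.\<close>
    have "c * (\<Sum>i\<in>UNIV. inverse (l i - m)) = (\<Sum>i\<in>UNIV. a i)"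
      unfolding sum_distrib_left
      using c nz by (intro sum.cong) (auto simp: field_simps)
    then show ?thesis
      using nz False a(1) by (simp add: pred_esym_eq_prod_mult_sum_inverse)
  qed
qed

lemma zero_sum_form_nonneg:
  fixes l :: "'n::finite \<Rightarrow> real"
  assumes nz: "\<And>t. t < 0 \<Longrightarrow> pred_esym (\<lambda>i. l i - t) \<noteq> 0" and b: "(\<Sum>i\<in>UNIV. b i) = 0"
  shows "0 \<le> (\<Sum>i\<in>UNIV. l i * (b i)\<^sup>2)"
\<comment> \<open>A nonzero \<open>b\<close> guarantees that the hyperplane contains unit vectors to
  minimize over; for size one it is \<open>{0}\<close>.\<close>
proof (cases "\<forall>i. b i = 0")
  case False
  define F where "F = (\<lambda>x :: real ^ 'n. \<Sum>i\<in>UNIV. l i * (x $ i)\<^sup>2)"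
  define S where "S = {x :: real ^ 'n. (\<Sum>i\<in>UNIV. x $ i) = 0}"
  have Fscale: "F (s *\<^sub>R x) = s\<^sup>2 * F x" for s x
    by (simp add: F_def sum_distrib_left power_mult_distrib mult_ac)
  have scale: "x /\<^sub>R norm x \<in> S \<inter> sphere 0 1" if "x \<in> S" "x \<noteq> 0" for x
    using that by (simp add: S_def flip: sum_distrib_left)
  define v where "v = (\<chi> i. b i)"
  have v: "v \<in> S" "v \<noteq> 0"
    using b False by (auto simp: v_def S_def vec_eq_iff)
  have "S \<inter> sphere 0 1 \<noteq> {}"
    using scale [OF v] by blast
  moreover have "closed S"
    unfolding S_def by (intro closed_Collect_eq continuous_intros)
  then have "compact (S \<inter> sphere 0 1)"
    by (intro closed_Int_compact compact_sphere)
  moreover have "continuous_on (S \<inter> sphere 0 1) F"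
    unfolding F_def by (intro continuous_intros)
  ultimately obtain a where a: "a \<in> S" "norm a = 1"
    and min: "\<And>x. x \<in> S \<inter> sphere 0 1 \<Longrightarrow> F a \<le> F x"
    using continuous_attains_inf [of "S \<inter> sphere 0 1" F] by fastforce
  have low: "F a * (norm x)\<^sup>2 \<le> F x" if "x \<in> S" for x
  proof (cases "x = 0")
    case False
    from min [OF scale [OF that this]] show ?thesis
      using False by (simp add: Fscale power_inverse field_simps)
  qed (simp add: F_def)
  have nrm: "(norm x)\<^sup>2 = (\<Sum>i\<in>UNIV. (x $ i)\<^sup>2)" for x :: "real ^ 'n"
    unfolding power2_norm_eq_inner inner_vec_def by (simp add: power2_eq_square)
  have form: "(\<Sum>i\<in>UNIV. (l i - F a) * (x $ i)\<^sup>2) = F x - F a * (norm x)\<^sup>2" for x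
    by (simp add: nrm F_def left_diff_distrib sum_subtractf sum_distrib_left)
  obtain k where k: "a $ k \<noteq> 0"
    using a(2) by (metis norm_zero vec_eq_iff zero_index zero_neq_one)
  have "pred_esym (\<lambda>i. l i - F a) = 0"
  proof (rule pred_esym_shift_zero_at_minimum [where a = "\<lambda>i. a $ i", OF _ _ _ k])
    fix x :: "'n \<Rightarrow> real" assume "(\<Sum>i\<in>UNIV. x i) = 0"
    then show "0 \<le> (\<Sum>i\<in>UNIV. (l i - F a) * (x i)\<^sup>2)"
      using form [of "\<chi> i. x i"] low [of "\<chi> i. x i"] by (simp add: S_def)
  qed (use a form [of a] in \<open>auto simp: S_def\<close>)
  then have "0 \<le> F a"
    using nz [of "F a"] by force
  then have "0 \<le> F v"
    using low [OF v(1)] by (meson mult_nonneg_nonneg order_trans zero_le_power2)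
  then show ?thesis
    by (simp add: F_def v_def)
qed simp

section \<open>Passage from diagonalized matrices to their eigenvalues\<close>

lemma diag_conj_nth:
  "(Q ** diag_mat l ** transpose Q) $ i $ j = (\<Sum>k\<in>UNIV. Q $ i $ k * l k * Q $ j $ k)"
  by (simp add: matrix_matrix_mult_def diag_mat_def transpose_def if_distrib cong: if_cong)

lemma diag_conj_diff:
  "Q ** diag_mat (\<lambda>i. f i - g i) ** transpose Q =
    Q ** diag_mat f ** transpose Q - Q ** diag_mat g ** transpose Q"
  by (simp add: vec_eq_iff diag_conj_nth algebra_simps sum_subtractf)

text \<open>The scalar matrix is itself \<open>Q ** diag_mat (\<lambda>_. t) ** transpose Q\<close>,
  so the difference is a conjugated diagonal matrix. This supplies the hypothesis of
  \<open>E_pred_eigenvalues\<close>.\<close>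

lemma det_diagonalized_shift:
  assumes "orthogonal_matrix Q"
  shows "det (t *\<^sub>R mat 1 - Q ** diag_mat l ** transpose Q) = (\<Prod>i\<in>UNIV. t - l i)"
proof -
  have QQ: "Q ** transpose Q = mat 1"
    using assms by (simp add: orthogonal_matrix_def)
  have "Q ** diag_mat (\<lambda>_. t) ** transpose Q = t *\<^sub>R (Q ** transpose Q)"
    by (simp add: vec_eq_iff diag_conj_nth)
      (simp add: matrix_matrix_mult_def transpose_def sum_distrib_left mult_ac)
  then have "t *\<^sub>R mat 1 - Q ** diag_mat l ** transpose Q = Q ** diag_mat (\<lambda>i. t - l i) ** transpose Q"
    by (simp add: QQ diag_conj_diff)
  moreover have "det Q * det (transpose Q) = 1"
    by (metis QQ det_I det_mul)
  moreover have "det (diag_mat (\<lambda>i. t - l i)) = (\<Prod>i\<in>UNIV. t - l i)"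
    by (subst det_diagonal) (auto simp: diag_mat_def)
  ultimately show ?thesis
    by (simp add: det_mul mult_ac)
qed

lemma map_poly_of_real_sum:
  "map_poly of_real (\<Sum>i\<in>A. p i) = (\<Sum>i\<in>A. map_poly of_real (p i))"
  by (simp add: poly_eq_iff coeff_map_poly coeff_sum)

lemma map_poly_of_real_prod:
  "map_poly of_real (\<Prod>i\<in>A. p i) =
    (\<Prod>i\<in>A. map_poly of_real (p i) :: 'a::{real_algebra_1,comm_ring_1} poly)"
proof (induction A rule: infinite_finite_induct)
  case (insert x A)
  have "map_poly of_real (p x * q) = map_poly of_real (p x) * (map_poly of_real q :: 'a poly)" for q
    by (simp add: poly_eq_iff coeff_map_poly coeff_mult)
  with insert show ?case
    by simp
qed (auto simp: map_poly_1)

lemma mem_first_derivative_relaxation_iff: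
  assumes X: "X \<in> sym_matrices" and Q: "orthogonal_matrix Q"
    and diag: "X = Q ** diag_mat l ** transpose Q"
  shows "X \<in> first_derivative_relaxation \<longleftrightarrow>
    (\<forall>a. (\<Sum>i\<in>UNIV. a i) = 0 \<longrightarrow> 0 \<le> (\<Sum>i\<in>UNIV. l i * (a i)\<^sup>2))"
    (is "_ \<longleftrightarrow> ?P")
proof -
  \<comment> \<open>Taken over the polynomial ring, this is the only possible witness in
    \<open>hyperbolicity_cone\<close>, as \<open>uniq\<close> confirms.\<close>
  define q where "q = pred_esym (\<lambda>i. [:l i, -1:])"
  have E: "E_pred (X - t *\<^sub>R mat 1) = poly q t" for t
  proof -
    have "det (s *\<^sub>R mat 1 - (X - t *\<^sub>R mat 1)) = (\<Prod>i\<in>UNIV. s - (l i - t))" for s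
      using det_diagonalized_shift [OF Q, of "s + t" l] diag
      by (simp add: algebra_simps)
    then show ?thesis
      by (simp add: E_pred_eigenvalues q_def pred_esym_def poly_sum poly_prod)
  qed
  have real_poly: "poly q t = pred_esym (\<lambda>i. l i - t)" for t
    by (simp add: q_def pred_esym_def poly_sum poly_prod)
  have cpoly: "poly (map_poly complex_of_real q) z = pred_esym (\<lambda>i. complex_of_real (l i) - z)" for z
  proof -
    have "map_poly complex_of_real q = pred_esym (\<lambda>i. map_poly complex_of_real [:l i, -1:])"
      unfolding q_def pred_esym_def
      by (simp add: map_poly_of_real_sum map_poly_of_real_prod)
    then show ?thesis
      by (simp add: pred_esym_def poly_sum poly_prod map_poly_pCons)
  qed
  have of_real_esym: "pred_esym (\<lambda>i. complex_of_real (l i) - complex_of_real t) =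
      complex_of_real (pred_esym (\<lambda>i. l i - t))" for t
    by (simp add: pred_esym_def)
  have uniq: "(\<forall>t. poly p t = E_pred (X - t *\<^sub>R mat 1)) \<longleftrightarrow> p = q" for p
    by (simp add: E fun_eq_iff flip: poly_eq_poly_eq_iff)
  have "X \<in> first_derivative_relaxation \<longleftrightarrow>
      (\<forall>z. pred_esym (\<lambda>i. complex_of_real (l i) - z) = 0 \<longrightarrow> z \<in> \<real>\<^sub>\<ge>\<^sub>0)"
    using X unfolding first_derivative_relaxation_def hyperbolicity_cone_def
    by (simp add: uniq cpoly)
  also have "\<dots> \<longleftrightarrow> (\<forall>t<0. pred_esym (\<lambda>i. l i - t) \<noteq> 0)"
  proof safe
    fix t :: real
    assume *: "\<forall>z. pred_esym (\<lambda>i. complex_of_real (l i) - z) = 0 \<longrightarrow> z \<in> \<real>\<^sub>\<ge>\<^sub>0"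
      and t: "t < 0" "pred_esym (\<lambda>i. l i - t) = 0"
    have "complex_of_real t \<in> \<real>\<^sub>\<ge>\<^sub>0"
      by (intro * [rule_format]) (simp add: of_real_esym t(2))
    then show False
      using t by simp
  next
    fix z
    assume *: "\<forall>t<0. pred_esym (\<lambda>i. l i - t) \<noteq> 0"
      and z: "pred_esym (\<lambda>i. complex_of_real (l i) - z) = 0"
    have "Im z = 0"
      using z pred_esym_nonreal_shift by blast
    then have zr: "z = complex_of_real (Re z)"
      by (simp add: complex_eq_iff)
    then have "pred_esym (\<lambda>i. l i - Re z) = 0"
      using z of_real_esym [of "Re z"] by simp
    then have "\<not> Re z < 0"
      using * by blast
    then show "z \<in> \<real>\<^sub>\<ge>\<^sub>0"
      using \<open>Im z = 0\<close> by (simp add: complex_nonneg_Reals_iff)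
  qed
  also have "\<dots> \<longleftrightarrow> ?P"
    using pred_esym_shift_nonzero [of l] zero_sum_form_nonneg [of l] by blast
  finally show ?thesis .
qed

section \<open>The quadratic form on trace-zero symmetric matrices\<close>

lemma trace_mult_cyclic:
  fixes A B C :: "real ^ 'n ^ 'n"
  shows "trace (A ** B ** C) = trace (C ** A ** B)"
  by (metis matrix_mul_assoc trace_mul_sym)

lemma trace_transpose: "trace (transpose A) = trace A"
  by (simp add: trace_def transpose_def)

lemma trace_diag_form:
  fixes A :: "real ^ 'n ^ 'n"
  assumes "transpose A = A"
  shows "trace (A ** diag_mat l ** A) = (\<Sum>i\<in>UNIV. \<Sum>j\<in>UNIV. l j * (A $ i $ j)\<^sup>2)"
proof -
  have "A $ j $ i = A $ i $ j" for i j
    by (metis assms transpose_def vec_lambda_beta)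
  then show ?thesis
    by (simp add: trace_def matrix_matrix_mult_def diag_mat_def if_distrib power2_eq_square mult_ac
        cong: if_cong)
qed

text \<open>Averaging the double sum with its transpose gives the weights \<open>l i + l j\<close>.
  Off the diagonal these are nonnegative; the diagonal of \<open>A\<close> is a zero-sum vector
  because the trace vanishes.\<close>

lemma zero_sum_form_imp_trace_form_nonneg:
  fixes A :: "real ^ 'n ^ 'n"
  assumes psd: "\<And>a. (\<Sum>i\<in>UNIV. a i) = 0 \<Longrightarrow> 0 \<le> (\<Sum>i\<in>UNIV. l i * (a i)\<^sup>2)"
    and A: "transpose A = A" "trace A = 0"
  shows "0 \<le> trace (A ** diag_mat l ** A)"
proof -
  have sym: "A $ j $ i = A $ i $ j" for i j
    by (metis A(1) transpose_def vec_lambda_beta)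
  have pair: "0 \<le> l i + l j" if "i \<noteq> j" for i j
  proof -
    let ?a = "\<lambda>r. (if r = i then 1 else 0) - (if r = j then 1 else 0) :: real"
    have "0 \<le> (\<Sum>r\<in>UNIV. l r * (?a r)\<^sup>2)"
      by (rule psd) (simp add: sum_subtractf)
    also have "\<dots> = (\<Sum>r\<in>UNIV. (if r = i then l r else 0) + (if r = j then l r else 0))"
      using that by (intro sum.cong) auto
    finally show ?thesis
      by (simp add: sum.distrib)
  qed
  let ?f = "\<lambda>i j. l j * (A $ i $ j)\<^sup>2"
  have "2 * trace (A ** diag_mat l ** A) = (\<Sum>i\<in>UNIV. \<Sum>j\<in>UNIV. ?f i j) + (\<Sum>i\<in>UNIV. \<Sum>j\<in>UNIV. ?f j i)"
    unfolding trace_diag_form [OF A(1)] by (subst (3) sum.swap) simp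
  also have "\<dots> = (\<Sum>i\<in>UNIV. \<Sum>j\<in>UNIV. (l i + l j) * (A $ i $ j)\<^sup>2)"
    by (simp add: sum.distrib distrib_right sym)
  also have "\<dots> = (\<Sum>i\<in>UNIV. 2 * (l i * (A $ i $ i)\<^sup>2) + (\<Sum>j\<in>UNIV - {i}. (l i + l j) * (A $ i $ j)\<^sup>2))"
  proof (rule sum.cong)
    fix i :: 'n
    show "(\<Sum>j\<in>UNIV. (l i + l j) * (A $ i $ j)\<^sup>2) =
        2 * (l i * (A $ i $ i)\<^sup>2) + (\<Sum>j\<in>UNIV - {i}. (l i + l j) * (A $ i $ j)\<^sup>2)"
      by (simp add: sum.remove [of UNIV i])
  qed simp
  also have "\<dots> \<ge> (\<Sum>i\<in>UNIV. 2 * (l i * (A $ i $ i)\<^sup>2))"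
    using pair by (intro sum_mono) (auto intro!: sum_nonneg mult_nonneg_nonneg)
  moreover have "0 \<le> (\<Sum>i\<in>UNIV. l i * (A $ i $ i)\<^sup>2)"
    using A(2) by (intro psd) (simp add: trace_def)
  ultimately show ?thesis
    by (simp flip: sum_distrib_left)
qed

text \<open>Conjugation by \<open>Q\<close> preserves symmetry and trace and turns \<open>X\<close>
  into \<open>diag_mat l\<close>. One direction tests the conjugates of diagonal matrices, the other
  conjugates an arbitrary \<open>A\<close> back.\<close>

lemma trace_form_nonneg_iff:
  assumes Q: "orthogonal_matrix Q" and diag: "X = Q ** diag_mat l ** transpose Q"
  shows "(\<forall>A. A \<in> sym_matrices \<and> trace A = 0 \<longrightarrow> 0 \<le> trace (A ** X ** A)) \<longleftrightarrow>
    (\<forall>a. (\<Sum>i\<in>UNIV. a i) = 0 \<longrightarrow> 0 \<le> (\<Sum>i\<in>UNIV. l i * (a i)\<^sup>2))" (is "?L \<longleftrightarrow> ?R")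
proof -
  have QQ: "transpose Q ** Q = mat 1" "Q ** transpose Q = mat 1"
    using Q by (simp_all add: orthogonal_matrix_def)
  show ?thesis
  proof
    assume L: ?L
    show ?R
    proof (intro allI impI)
      fix a :: "'a \<Rightarrow> real"
      assume a: "(\<Sum>i\<in>UNIV. a i) = 0"
      define A where "A = Q ** diag_mat a ** transpose Q"
      have d: "transpose (diag_mat a) = diag_mat a"
        by (simp add: transpose_def diag_mat_def vec_eq_iff)
      have "trace A = trace (diag_mat a)"
        unfolding A_def by (subst trace_mult_cyclic) (simp add: QQ)
      then have "trace A = 0"
        using a by (simp add: trace_def diag_mat_def)
      moreover have "A \<in> sym_matrices"
        by (simp add: sym_matrices_def A_def matrix_transpose_mul d matrix_mul_assoc)
      ultimately have "0 \<le> trace (A ** X ** A)"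
        using L by blast
      also have "A ** X ** A = Q ** (diag_mat a ** diag_mat l ** diag_mat a) ** transpose Q"
      proof -
        have "A ** X ** A = Q ** diag_mat a ** (transpose Q ** Q) ** diag_mat l ** (transpose Q ** Q)
            ** diag_mat a ** transpose Q"
          by (simp only: A_def diag matrix_mul_assoc)
        then show ?thesis
          by (simp add: QQ matrix_mul_assoc)
      qed
      also have "trace \<dots> = trace (diag_mat a ** diag_mat l ** diag_mat a)"
        by (subst trace_mult_cyclic) (simp add: QQ matrix_mul_assoc)
      also have "\<dots> = (\<Sum>i\<in>UNIV. l i * (a i)\<^sup>2)"
      proof -
        have "l j * (diag_mat a $ i $ j)\<^sup>2 = (if i = j then l j * (a j)\<^sup>2 else 0)" for i j
          by (simp add: diag_mat_def)
        then show ?thesis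
          by (simp add: trace_diag_form [OF d])
      qed
      finally show "0 \<le> (\<Sum>i\<in>UNIV. l i * (a i)\<^sup>2)" .
    qed
  next
    assume R: ?R
    show ?L
    proof (intro allI impI)
      fix A :: "real ^ 'a ^ 'a"
      assume A: "A \<in> sym_matrices \<and> trace A = 0"
      define A' where "A' = transpose Q ** A ** Q"
      have "trace A' = trace A"
        unfolding A'_def by (subst trace_mult_cyclic) (simp add: QQ)
      then have "trace A' = 0"
        using A by simp
      moreover have "transpose A' = A'"
        using A by (simp add: sym_matrices_def A'_def matrix_transpose_mul matrix_mul_assoc)
      ultimately have "0 \<le> trace (A' ** diag_mat l ** A')"
        using R by (intro zero_sum_form_imp_trace_form_nonneg) auto
      also have "A' ** diag_mat l ** A' = transpose Q ** (A ** X ** A) ** Q"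
        by (simp only: A'_def diag matrix_mul_assoc)
      also have "trace \<dots> = trace (A ** X ** A)"
        by (subst trace_mult_cyclic) (simp add: QQ matrix_mul_assoc)
      finally show "0 \<le> trace (A ** X ** A)" .
    qed
  qed
qed

section \<open>Coordinates with respect to the given basis\<close>

lemma basis_family_span:
  assumes "basis_family I B V"
  shows "V = range (\<lambda>c. \<Sum>i\<in>I. c i *\<^sub>R B i)"
proof -
  have I: "finite I" "inj_on B I" "span (B ` I) = V"
    using assms by (auto simp: basis_family_def)
  have "V = range (\<lambda>u. \<Sum>v\<in>B ` I. u v *\<^sub>R v)"
    using I by (simp add: span_finite flip: I(3))
  also have "\<dots> = range (\<lambda>u. \<Sum>i\<in>I. u (B i) *\<^sub>R B i)"
    using I(2) by (simp add: sum.reindex)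
  also have "\<dots> = range (\<lambda>c. \<Sum>i\<in>I. c i *\<^sub>R B i)"
  proof safe
    fix c :: "'a \<Rightarrow> real"
    have "(\<Sum>i\<in>I. c i *\<^sub>R B i) = (\<Sum>i\<in>I. c (the_inv_into I B (B i)) *\<^sub>R B i)"
      using I(2) by (intro sum.cong) (simp_all add: the_inv_into_f_f)
    then show "(\<Sum>i\<in>I. c i *\<^sub>R B i) \<in> range (\<lambda>u. \<Sum>i\<in>I. u (B i) *\<^sub>R B i)"
      \<comment> \<open>Injectivity of \<open>B\<close> lets coefficients on indices be read as
        coefficients on basis vectors.\<close>
      by (intro image_eqI [where x = "\<lambda>v. c (the_inv_into I B v)"]) auto
  qed auto
  finally show ?thesis .
qed

lemma linear_trace_mult:
  fixes X :: "real ^ 'n ^ 'n"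
  shows "linear (\<lambda>A. trace (A ** X ** C))" "linear (\<lambda>A. trace (C ** X ** A))"
  by (intro linearI; simp add: trace_def matrix_matrix_mult_def sum_distrib_left sum.distrib
      distrib_left distrib_right mult_ac)+

lemma trace_form_expansion:
  fixes X :: "real ^ 'n ^ 'n"
  shows "trace ((\<Sum>i\<in>I. c i *\<^sub>R B i) ** X ** (\<Sum>i\<in>I. c i *\<^sub>R B i)) =
    (\<Sum>i\<in>I. \<Sum>j\<in>I. c i * trace (B i ** X ** B j) * c j)"
  by (simp add: linear_sum [OF linear_trace_mult(1)] linear_sum [OF linear_trace_mult(2)]
      linear_scale [OF linear_trace_mult(1)] linear_scale [OF linear_trace_mult(2)]
      sum_distrib_left mult_ac) (subst sum.swap, simp only: mult_ac)

text \<open>The form of the matrix at \<open>c\<close> is the trace form at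
  \<open>\<Sum>i\<in>I. c i *\<^sub>R B i\<close>, which runs through all of \<open>V\<close>. The
  symmetry demanded by \<open>psd_on\<close> follows by transposing under the trace.\<close>

lemma psd_on_trace_form_iff:
  fixes X :: "real ^ 'n ^ 'n"
  assumes basis: "basis_family I B V" and V: "V \<subseteq> sym_matrices" and X: "X \<in> sym_matrices"
  shows "psd_on I (\<lambda>i j. trace (B i ** X ** B j)) \<longleftrightarrow> (\<forall>A\<in>V. 0 \<le> trace (A ** X ** A))"
proof -
  have "B i \<in> V" if "i \<in> I" for i
    using basis that by (auto simp: basis_family_def intro: span_base)
  then have B: "transpose (B i) = B i" if "i \<in> I" for i
    using that V by (auto simp: sym_matrices_def)
  have "trace (B i ** X ** B j) = trace (B j ** X ** B i)" if "i \<in> I" "j \<in> I" for i j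
  proof -
    have "transpose (B i ** X ** B j) = B j ** X ** B i"
      using X that B by (simp add: matrix_transpose_mul sym_matrices_def matrix_mul_assoc)
    then show ?thesis
      by (metis trace_transpose)
  qed
  then show ?thesis
    unfolding psd_on_def basis_family_span [OF basis] by (auto simp: trace_form_expansion)
qed

theorem theorem1:
  fixes B :: "nat \<Rightarrow> real ^ 'n ^ 'n" and d :: nat
  assumes "d = ((CARD('n) + 1) choose 2) - 1"
    and "basis_family {1..d} B {A. A \<in> sym_matrices \<and> trace A = 0}"
  shows "(first_derivative_relaxation :: (real ^ 'n ^ 'n) set) =
         {X \<in> sym_matrices. psd_on {1..d} (\<lambda>i j. trace (B i ** X ** B j))}"
proof -
  have "X \<in> first_derivative_relaxation \<longleftrightarrow> psd_on {1..d} (\<lambda>i j. trace (B i ** X ** B j))"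
    if X: "X \<in> sym_matrices" for X :: "real ^ 'n ^ 'n"
  proof -
    obtain Q l where Q: "orthogonal_matrix Q" "X = Q ** diag_mat l ** transpose Q"
      using X symmetric_matrix_diagonalization by (auto simp: sym_matrices_def)
    have "psd_on {1..d} (\<lambda>i j. trace (B i ** X ** B j)) \<longleftrightarrow>
        (\<forall>A. A \<in> sym_matrices \<and> trace A = 0 \<longrightarrow> 0 \<le> trace (A ** X ** A))"
      using psd_on_trace_form_iff [OF assms(2) _ X] by auto
    then show ?thesis
      using mem_first_derivative_relaxation_iff [OF X Q] trace_form_nonneg_iff [OF Q] by simp
  qed
  \<comment> \<open>Both sides consist of symmetric matrices, so the equivalence for symmetric
    \<open>X\<close> is enough.\<close>
  moreover have "first_derivative_relaxation \<subseteq> (sym_matrices :: (real ^ 'n ^ 'n) set)"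
    by (auto simp: first_derivative_relaxation_def hyperbolicity_cone_def)
  ultimately show ?thesis
    by blast
qed

end
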